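(* Let $G=(\mathcal V,\mathcal E)$ be a network, possibly with cycles, with source $S$ and set of destinations $\mathcal T=\{T_1,\dots,T_{|\mathcal T|}\}$, over a finite field $\mathbb F_q$, and let $A(D)$, $B(D)$ and $F$ be the encoding, decoding and adjacency matrices defined by: $A(D)$ has rows indexed by the source processes and columns by the ports, with $A_{i,j}=\alpha_{(i,e_j)}(D)$ if $e_j\in O(S)$ and $X(S,i)\in\mathcal X(S)$, and $A_{i,j}=0$ otherwise; $B(D)$ has rows indexed by the destination processes $(T_j,k)$ and columns by the ports, with the entry in row $(T_j,k)$ and column $e_i$ equal to $\epsilon_{(e_i,(T_j,k))}(D)$ if $e_i\in I(T_j)$ and $Z(T_j,k)\in\mathcal Z(T_j)$, and $0$ otherwise; $F_{i,j}=1$ if $(e_i,e_j)\in\mathcal E$, $F_{i,j}=\beta_{(e_i,e_j)}$ if $e_i\in I(V)$ and $e_j\in O(V)$ for some $V\in\mathcal V$, and $F_{i,j}=0$ otherwise. The variables $\alpha_{(i,e_j)}(D)$ and $\epsilon_{(e_i,(T_j,k))}(D)$ can either be constants or rational functions in $D$. Then the system matrix $M(D)$ of the network with delay (which may include cycles), i.e. the matrix with $\mathcal Z(D)=\mathcal X(S,D)\,M(D)$, is $$M(D)=A(D)\cdot(I-DF)^{-1}\cdot B(D)^T.$$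
   Context: Network. $G=(\mathcal V,\mathcal E)$ consists of a finite set $\mathcal V$ of nodes; each node $V$ has a finite set $I(V)$ of input ports and a finite set $O(V)$ of output ports (all pairwise disjoint). Each edge in $\mathcal E$ is an ordered pair $(e_1,e_2)$ with $e_1\in O(V_1)$ and $e_2\in I(V_2)$ for some $V_1,V_2\in\mathcal V$; directed cycles are allowed. Let $e_1,e_2,\dots$ enumerate all ports. Processes with delay. Processes are time-indexed sequences over $\mathbb F_q$, written as power series in the delay variable $D$: source processes $X(S,i,D)=\sum_{t\ge0}X_t(S,i)D^t$, forming the row vector $\mathcal X(S,D)$; port processes $Y(e,D)=\sum_tY_t(e)D^t$, forming the row vector $Y(D)$ indexed by the ports; destination processes $Z(T_j,k,D)=\sum_tZ_t(T_j,k)D^t$, forming the row vectors $\mathcal Z(T_j,D)$, and $\mathcal Z(D)=[\mathcal Z(T_1,D),\dots,\mathcal Z(T_{|\mathcal T|},D)]$. With rational functions as encoding/decoding coefficients, everything is viewed in the field $\mathbb F_q((D))$ of formal Laurent series. Every transition between ports described by a nonzero entry of $F$ (an edge from an output to an input port, where arriving symbols are added, or a transition with coefficient $\beta_{(e',e)}\in\mathbb F_q$ from an input port to an output port of the same node) takes one unit of time, and there is zero initial state: thus $Y(D)=D\,Y(D)F+\mathcal X(S,D)A(D)$, and the destination processes are $\mathcal Z(D)=Y(D)B(D)^T$. Any delay in injecting source symbols or producing outputs is absorbed in the rational functions $\alpha_{(i,e_j)}(D)$ and $\epsilon_{(e_i,(T_j,k))}(D)$. *)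

theory Defs
  imports
    "Jordan_Normal_Form.Gauss_Jordan_Elimination"
    "HOL-Computational_Algebra.Polynomial_FPS"
    "HOL-Computational_Algebra.Formal_Laurent_Series"
    "HOL-Library.Disjoint_Sets"
begin

text \<open>
  The lists \<open>ports\<close> and \<open>dests\<close> fix the enumerations \<open>e\<^sub>1, e\<^sub>2, \<dots>\<close> of the ports and
  \<open>T\<^sub>1, \<dots>, T\<^bsub>|\<T>|\<^esub>\<close> of the destinations. The source processes are \<open>X(S,i)\<close> for
  \<open>i < num_src\<close>, and the processes of a destination \<open>T\<close> are \<open>Z(T,k)\<close> for \<open>k < num_dst T\<close>
  (indices start at 0).
\<close>

record (overloaded) ('v, 'p, 'a) coded_network =
  nodes :: "'v set"
  inp :: "'v \<Rightarrow> 'p set"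
  outp :: "'v \<Rightarrow> 'p set"
  edges :: "('p \<times> 'p) set"
  source :: 'v
  dests :: "'v list"
  ports :: "'p list"
  num_src :: nat
  num_dst :: "'v \<Rightarrow> nat"
  alpha :: "nat \<times> 'p \<Rightarrow> 'a fls"
  beta :: "'p \<times> 'p \<Rightarrow> 'a"
  eps :: "'p \<times> ('v \<times> nat) \<Rightarrow> 'a fls"

definition rational_fls :: "'a::field fls \<Rightarrow> bool" where
  "rational_fls f \<longleftrightarrow>
     (\<exists>p q. q \<noteq> 0 \<and> f = fps_to_fls (fps_of_poly p) / fps_to_fls (fps_of_poly q))"

locale network =
  fixes N :: "('v, 'p, 'a::{field, finite}) coded_network"
  assumes finite_nodes: "finite (nodes N)"
    and finite_inp: "\<And>v. v \<in> nodes N \<Longrightarrow> finite (inp N v)"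
    and finite_outp: "\<And>v. v \<in> nodes N \<Longrightarrow> finite (outp N v)"
    and disjoint_inp: "disjoint_family_on (inp N) (nodes N)"
    and disjoint_outp: "disjoint_family_on (outp N) (nodes N)"
    and disjoint_inp_outp: "\<And>u v. u \<in> nodes N \<Longrightarrow> v \<in> nodes N \<Longrightarrow> inp N u \<inter> outp N v = {}"
    and edges: "edges N \<subseteq> (\<Union>v\<in>nodes N. outp N v) \<times> (\<Union>v\<in>nodes N. inp N v)"
    and source: "source N \<in> nodes N"
    and dests: "distinct (dests N)" "set (dests N) \<subseteq> nodes N"
    and ports: "distinct (ports N)" "set (ports N) = (\<Union>v\<in>nodes N. inp N v \<union> outp N v)"
    and rational_alpha:
      "\<And>i e. i < num_src N \<Longrightarrow> e \<in> outp N (source N) \<Longrightarrow> rational_fls (alpha N (i, e))"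
    and rational_eps:
      "\<And>T k e. T \<in> set (dests N) \<Longrightarrow> k < num_dst N T \<Longrightarrow> e \<in> inp N T \<Longrightarrow>
         rational_fls (eps N (e, (T, k)))"

definition num_ports :: "('v, 'p, 'a) coded_network \<Rightarrow> nat" where
  "num_ports N = length (ports N)"

text \<open>Enumeration of the pairs \<open>(T\<^sub>j, k)\<close> in the order \<open>[\<Z>(T\<^sub>1), \<dots>, \<Z>(T\<^bsub>|\<T>|\<^esub>)]\<close>.\<close>

definition dest_procs :: "('v, 'p, 'a) coded_network \<Rightarrow> ('v \<times> nat) list" where
  "dest_procs N = concat (map (\<lambda>T. map (Pair T) [0..<num_dst N T]) (dests N))"

definition num_dest_procs :: "('v, 'p, 'a) coded_network \<Rightarrow> nat" where
  "num_dest_procs N = length (dest_procs N)"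

definition encoding_mat :: "('v, 'p, 'a::field) coded_network \<Rightarrow> 'a fls mat" where
  "encoding_mat N = mat (num_src N) (num_ports N)
     (\<lambda>(i, j). if ports N ! j \<in> outp N (source N) then alpha N (i, ports N ! j) else 0)"

definition decoding_mat :: "('v, 'p, 'a::field) coded_network \<Rightarrow> 'a fls mat" where
  "decoding_mat N = mat (num_dest_procs N) (num_ports N)
     (\<lambda>(r, i). if ports N ! i \<in> inp N (fst (dest_procs N ! r))
               then eps N (ports N ! i, dest_procs N ! r) else 0)"

definition adjacency_mat :: "('v, 'p, 'a::field) coded_network \<Rightarrow> 'a mat" where
  "adjacency_mat N = mat (num_ports N) (num_ports N)
     (\<lambda>(i, j). if (ports N ! i, ports N ! j) \<in> edges N then 1
               else if \<exists>v\<in>nodes N. ports N ! i \<in> inp N v \<and> ports N ! j \<in> outp N v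
               then beta N (ports N ! i, ports N ! j)
               else 0)"

text \<open>\<open>D\<cdot>F\<close> over the Laurent series field; the delay variable \<open>D\<close> is \<^const>\<open>fls_X\<close>.\<close>

definition delayed_adjacency_mat :: "('v, 'p, 'a::field) coded_network \<Rightarrow> 'a fls mat" where
  "delayed_adjacency_mat N = fls_X \<cdot>\<^sub>m map_mat fls_const (adjacency_mat N)"

text \<open>
  Row vectors are matrices with one row. Source processes are power series. Port and destination
  processes are Laurent series, because the rational functions \<open>\<alpha>\<close> and \<open>\<epsilon>\<close> may have a pole
  at 0. The coefficient of \<open>D\<^sup>t\<close> in the second equation is \<open>Y\<^sub>t = Y\<^bsub>t-1\<^esub> F + (X A)\<^sub>t\<close>: every
  transition takes one unit of time, and the absence of a further additive term is the zero
  initial state.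
\<close>

definition network_processes ::
  "('v, 'p, 'a::field) coded_network \<Rightarrow> 'a fps mat \<Rightarrow> 'a fls mat \<Rightarrow> 'a fls mat \<Rightarrow> bool" where
  "network_processes N X Y Z \<longleftrightarrow>
     X \<in> carrier_mat 1 (num_src N) \<and>
     Y \<in> carrier_mat 1 (num_ports N) \<and>
     Y = fls_X \<cdot>\<^sub>m (Y * map_mat fls_const (adjacency_mat N))
           + map_mat fps_to_fls X * encoding_mat N \<and>
     Z = Y * transpose_mat (decoding_mat N)"

definition is_system_matrix :: "('v, 'p, 'a::field) coded_network \<Rightarrow> 'a fls mat \<Rightarrow> bool" where
  "is_system_matrix N M \<longleftrightarrow>
     M \<in> carrier_mat (num_src N) (num_dest_procs N) \<and>
     (\<forall>X Y Z. network_processes N X Y Z \<longrightarrow> Z = map_mat fps_to_fls X * M)"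

end

theory Submission
  imports
    Defs
    "Jordan_Normal_Form.Determinant"
begin

text \<open>
  The matrix \<open>I - DF\<close> has power series entries and reduces to \<open>I\<close> at \<open>D = 0\<close>, so its determinant
  is a power series with constant coefficient 1, hence a nonzero Laurent series. Therefore the
  state equation \<open>Y = DYF + XA\<close>, i.e. \<open>Y(I - DF) = XA\<close>, has exactly one solution, and the resulting
  linear map from \<open>X\<close> to \<open>Z\<close> determines its matrix by its values on the unit row vectors.
\<close>

text \<open>Determinants commute with ring homomorphisms. This embedding and the evaluation at D = 0
  below carry a determinant from Laurent series to power series and from there to the base
  field.\<close>

lemma comm_ring_hom_fps_to_fls: "comm_ring_hom (fps_to_fls :: 'a::comm_ring_1 fps \<Rightarrow> 'a fls)"
  by unfold_locales (simp_all add: fls_times_fps_to_fls)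

lemma comm_ring_hom_fps_nth_0: "comm_ring_hom (\<lambda>f :: 'a::comm_ring_1 fps. fps_nth f 0)"
  by unfold_locales simp_all

lemma det_one_minus_X_smult_neq_0:
  fixes F :: "'a::field mat"
  assumes F: "F \<in> carrier_mat n n"
  shows "det (1\<^sub>m n - fls_X \<cdot>\<^sub>m map_mat fls_const F) \<noteq> 0"
proof -
  \<comment> \<open>Taking the coefficient of D^0 is multiplicative on power series but not on
    Laurent series, so the matrix is first lifted to one over power series.\<close>
  define P where "P = 1\<^sub>m n - fps_X \<cdot>\<^sub>m map_mat fps_const F"
  have "1\<^sub>m n - fls_X \<cdot>\<^sub>m map_mat fls_const F = map_mat fps_to_fls P"
    using F by (intro eq_matI)
      (auto simp: P_def fls_times_fps_to_fls)
  then have det: "det (1\<^sub>m n - fls_X \<cdot>\<^sub>m map_mat fls_const F) = fps_to_fls (det P)"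
    by (simp add: comm_ring_hom.hom_det[OF comm_ring_hom_fps_to_fls])
  have "map_mat (\<lambda>f. fps_nth f 0) P = 1\<^sub>m n"
    using F by (intro eq_matI) (auto simp: P_def)
  then have "fps_nth (det P) 0 = 1"
    by (simp flip: comm_ring_hom.hom_det[OF comm_ring_hom_fps_nth_0])
  then show ?thesis
    by (auto simp: det)
qed

text \<open>A nonzero determinant makes the matrix a unit of the matrix ring, which excludes the
  result \<open>None\<close>; hence \<open>the\<close> yields a genuine two-sided inverse.\<close>

lemma mat_inverse_det_neq_0:
  fixes A :: "'a::field mat"
  assumes A: "A \<in> carrier_mat n n" and "det A \<noteq> 0"
  shows "the (mat_inverse A) \<in> carrier_mat n n"
    and "A * the (mat_inverse A) = 1\<^sub>m n"
    and "the (mat_inverse A) * A = 1\<^sub>m n"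
proof -
  have "A \<in> Units (ring_mat TYPE('a) n ())"
    using assms by (rule det_non_zero_imp_unit)
  then obtain B where "mat_inverse A = Some B"
    using mat_inverse(1)[OF A] by fastforce
  then show "the (mat_inverse A) \<in> carrier_mat n n"
    and "A * the (mat_inverse A) = 1\<^sub>m n"
    and "the (mat_inverse A) * A = 1\<^sub>m n"
    using mat_inverse(2)[OF A] by auto
qed

lemma mat_mult_eq_iff_inverse:
  fixes C :: "'a::comm_ring_1 mat"
  assumes "Y \<in> carrier_mat m n" "U \<in> carrier_mat m n"
    and "C \<in> carrier_mat n n" "K \<in> carrier_mat n n"
    and "C * K = 1\<^sub>m n" "K * C = 1\<^sub>m n"
  shows "Y * C = U \<longleftrightarrow> Y = U * K"
proof
  assume "Y * C = U"
  moreover have "Y * C * K = Y"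
    using assms by (simp add: assoc_mult_mat[of Y m n C n K n] right_mult_one_mat[of Y m])
  ultimately show "Y = U * K" by simp
next
  assume "Y = U * K"
  moreover have "U * K * C = U"
    using assms by (simp add: assoc_mult_mat[of U m n K n C n] right_mult_one_mat[of U m])
  ultimately show "Y * C = U" by simp
qed

lemma mat_eq_add_iff_mult_one_minus:
  fixes G :: "'a::comm_ring_1 mat"
  assumes Y: "Y \<in> carrier_mat m n" and U: "U \<in> carrier_mat m n" and G: "G \<in> carrier_mat n n"
  shows "Y = Y * G + U \<longleftrightarrow> Y * (1\<^sub>m n - G) = U"
proof -
  have "Y * (1\<^sub>m n - G) = Y - Y * G"
    using Y by (simp add: mult_minus_distrib_mat[OF Y one_carrier_mat G])
  moreover have "Y = Y * G + U \<longleftrightarrow> Y - Y * G = U"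
    using Y U G by (auto simp: mat_eq_iff algebra_simps)
  ultimately show ?thesis by simp
qed

text \<open>Source processes are power series only, but the unit row vectors are among them, and the
  i-th one extracts row i. This is what makes a system matrix unique.\<close>

lemma mat_eqI_fps_rows:
  fixes M M' :: "'a::field fls mat"
  assumes M: "M \<in> carrier_mat m n" and M': "M' \<in> carrier_mat m n"
    and eq: "\<And>X. X \<in> carrier_mat 1 m \<Longrightarrow> map_mat fps_to_fls X * M = map_mat fps_to_fls X * M'"
  shows "M = M'"
proof (rule eq_matI)
  fix i k assume "i < dim_row M'" "k < dim_col M'"
  then have i: "i < m" and k: "k < n" using M' by auto
  define X :: "'a fps mat" where "X = mat 1 m (\<lambda>(_, j). if j = i then 1 else 0)"
  have X: "X \<in> carrier_mat 1 m" by (simp add: X_def)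
  have entry: "(map_mat fps_to_fls X * L) $$ (0, k) = L $$ (i, k)" if "L \<in> carrier_mat m n" for L
  proof -
    have "(map_mat fps_to_fls X * L) $$ (0, k)
        = (\<Sum>j = 0..<m. fps_to_fls (if j = i then 1 else 0) * L $$ (j, k))"
      using that k by (simp add: X_def scalar_prod_def)
    also have "\<dots> = (\<Sum>j = 0..<m. if j = i then L $$ (j, k) else 0)"
      by (intro sum.cong) auto
    also have "\<dots> = L $$ (i, k)" using i by simp
    finally show ?thesis .
  qed
  show "M $$ (i, k) = M' $$ (i, k)"
    using eq[OF X] entry[OF M] entry[OF M'] by simp
qed (use M M' in auto)

context
  fixes N :: "('v, 'p, 'a::field) coded_network"
begin

abbreviation (input) transfer_inverse :: "'a fls mat" where
  "transfer_inverse \<equiv> the (mat_inverse (1\<^sub>m (num_ports N) - delayed_adjacency_mat N))"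

lemma network_mats_carrier [simp]:
  "encoding_mat N \<in> carrier_mat (num_src N) (num_ports N)"
  "decoding_mat N \<in> carrier_mat (num_dest_procs N) (num_ports N)"
  "adjacency_mat N \<in> carrier_mat (num_ports N) (num_ports N)"
  "delayed_adjacency_mat N \<in> carrier_mat (num_ports N) (num_ports N)"
  by (auto simp: encoding_mat_def decoding_mat_def adjacency_mat_def delayed_adjacency_mat_def)

lemma one_minus_delayed_adjacency_carrier:
  "1\<^sub>m (num_ports N) - delayed_adjacency_mat N \<in> carrier_mat (num_ports N) (num_ports N)"
  by (intro minus_carrier_mat) simp

lemma det_one_minus_delayed_adjacency_neq_0:
  "det (1\<^sub>m (num_ports N) - delayed_adjacency_mat N) \<noteq> 0"
  unfolding delayed_adjacency_mat_def by (rule det_one_minus_X_smult_neq_0) simp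

lemmas transfer_inverse = mat_inverse_det_neq_0
  [OF one_minus_delayed_adjacency_carrier det_one_minus_delayed_adjacency_neq_0]

text \<open>Moving the term with Y to one side gives Y(I - DF) = XA, and right multiplication by the
  inverse solves it. Thus X determines Y and Z by explicit formulas.\<close>

lemma network_processes_iff:
  assumes X: "X \<in> carrier_mat 1 (num_src N)"
  shows "network_processes N X Y Z \<longleftrightarrow>
    Y = map_mat fps_to_fls X * encoding_mat N * transfer_inverse \<and>
    Z = Y * transpose_mat (decoding_mat N)"
proof -
  let ?U = "map_mat fps_to_fls X * encoding_mat N"
  have U: "?U \<in> carrier_mat 1 (num_ports N)"
    using X by (intro mult_carrier_mat[where n = "num_src N"]) auto
  have "Y = fls_X \<cdot>\<^sub>m (Y * map_mat fls_const (adjacency_mat N)) + ?U \<longleftrightarrow> Y = ?U * transfer_inverse"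
    if Y: "Y \<in> carrier_mat 1 (num_ports N)"
  proof -
    \<comment> \<open>The scalar D is absorbed into the matrix, which brings the state equation into
      the form Y = Y G + U.\<close>
    have "fls_X \<cdot>\<^sub>m (Y * map_mat fls_const (adjacency_mat N)) = Y * delayed_adjacency_mat N"
      unfolding delayed_adjacency_mat_def
      by (rule mult_smult_distrib[OF Y, of _ "num_ports N", symmetric]) simp
    then show ?thesis
      using mat_eq_add_iff_mult_one_minus[OF Y U network_mats_carrier(4)]
        mat_mult_eq_iff_inverse[OF Y U one_minus_delayed_adjacency_carrier transfer_inverse]
      by simp
  qed
  \<comment> \<open>For the converse direction, the required shape of Y has to be recovered from its
    formula.\<close>
  moreover have "?U * transfer_inverse \<in> carrier_mat 1 (num_ports N)"
    using U transfer_inverse(1) by (rule mult_carrier_mat)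
  ultimately show ?thesis
    using X unfolding network_processes_def by blast
qed

text \<open>Every X of the right size admits processes, so the condition on M is never vacuous: it
  says that M and the claimed product act alike on all source rows, and unit rows then force
  equality.\<close>

lemma is_system_matrix_iff:
  "is_system_matrix N M \<longleftrightarrow>
    M = encoding_mat N * transfer_inverse * transpose_mat (decoding_mat N)"
proof -
  let ?M = "encoding_mat N * transfer_inverse * transpose_mat (decoding_mat N)"
  have M: "?M \<in> carrier_mat (num_src N) (num_dest_procs N)"
    using transfer_inverse(1)
    by (intro mult_carrier_mat[where n = "num_ports N"]) auto
  have out: "map_mat fps_to_fls X * encoding_mat N * transfer_inverse * transpose_mat (decoding_mat N)
      = map_mat fps_to_fls X * ?M"
    if X: "X \<in> carrier_mat 1 (num_src N)" for X
  proof -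
    have X': "map_mat fps_to_fls X \<in> carrier_mat 1 (num_src N)" using X by simp
    have E: "encoding_mat N * transfer_inverse \<in> carrier_mat (num_src N) (num_ports N)"
      using transfer_inverse(1) by (intro mult_carrier_mat) auto
    have B: "transpose_mat (decoding_mat N) \<in> carrier_mat (num_ports N) (num_dest_procs N)" by simp
    show ?thesis
      by (simp add: assoc_mult_mat[OF X' E B]
          assoc_mult_mat[OF X' network_mats_carrier(1) transfer_inverse(1)])
  qed
  have "is_system_matrix N M \<longleftrightarrow> M \<in> carrier_mat (num_src N) (num_dest_procs N) \<and>
      (\<forall>X \<in> carrier_mat 1 (num_src N). map_mat fps_to_fls X * ?M = map_mat fps_to_fls X * M)"
    unfolding is_system_matrix_def
  proof (intro conj_cong refl iffI ballI allI impI)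
    fix X :: "'a fps mat"
    assume eq: "\<forall>X Y Z. network_processes N X Y Z \<longrightarrow> Z = map_mat fps_to_fls X * M"
      and X: "X \<in> carrier_mat 1 (num_src N)"
    \<comment> \<open>The hypothesis is applied to the explicit solution Y and Z belonging to
      X.\<close>
    then show "map_mat fps_to_fls X * ?M = map_mat fps_to_fls X * M"
      using network_processes_iff[OF X] out[OF X] by simp
  next
    fix X Y Z
    assume eq: "\<forall>X\<in>carrier_mat 1 (num_src N). map_mat fps_to_fls X * ?M = map_mat fps_to_fls X * M"
      and XYZ: "network_processes N X Y Z"
    then have X: "X \<in> carrier_mat 1 (num_src N)" by (simp add: network_processes_def)
    show "Z = map_mat fps_to_fls X * M"
      using XYZ eq X network_processes_iff[OF X] out[OF X] by simp
  qed
  also have "\<dots> \<longleftrightarrow> M = ?M"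
    using M mat_eqI_fps_rows[of M _ _ ?M] by auto
  finally show ?thesis .
qed

end

theorem theorem16:
  fixes N :: "('v, 'p, 'a::{field, finite}) coded_network"
  assumes "network N"
  shows "invertible_mat (1\<^sub>m (num_ports N) - delayed_adjacency_mat N) \<and>
    (\<forall>X \<in> carrier_mat 1 (num_src N). \<exists>!(Y, Z). network_processes N X Y Z) \<and>
    (\<forall>M. is_system_matrix N M \<longleftrightarrow>
       M = encoding_mat N *
           the (mat_inverse (1\<^sub>m (num_ports N) - delayed_adjacency_mat N)) *
           transpose_mat (decoding_mat N))"
proof (intro conjI ballI allI)
  show "invertible_mat (1\<^sub>m (num_ports N) - delayed_adjacency_mat N)"
    unfolding invertible_mat_def inverts_mat_def
    \<comment> \<open>\<open>inverts_mat\<close> takes the size of its identity matrix from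
      \<open>dim_row\<close>, which is rewritten here to \<open>num_ports N\<close>.\<close>
    using carrier_matD[OF network_mats_carrier(4)[of N]] transfer_inverse[of N]
    by (intro conjI exI[of _ "transfer_inverse N"]) auto
next
  fix X :: "'a fps mat"
  assume "X \<in> carrier_mat 1 (num_src N)"
  from network_processes_iff[OF this] show "\<exists>!(Y, Z). network_processes N X Y Z"
    by auto
next
  fix M
  show "is_system_matrix N M \<longleftrightarrow>
       M = encoding_mat N *
           the (mat_inverse (1\<^sub>m (num_ports N) - delayed_adjacency_mat N)) *
           transpose_mat (decoding_mat N)"
    by (rule is_system_matrix_iff)
qed

end
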